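(* Let $\mathcal H_B,\mathcal H_A,\mathcal H_E,\mathcal H_X$ be finite-dimensional complex Hilbert spaces (battery, auxiliary, environment, external), let $H_B$ be a Hermitian operator on $\mathcal H_B$, and let $U_{BA}$ be a unitary on $\mathcal H_B\otimes\mathcal H_A$. The noise on the auxiliary is represented by a unitary $U_{AE}$ on $\mathcal H_A\otimes\mathcal H_E$, applied after $U_{BA}$ and before the measurement. (Type 1) For every initial state $\rho^0_S=\rho^0_{BAE}\otimes\rho_X$, the distillable energy $S^{NP_1}_D$, the maximum stochastically extractable energy $S^{NP_1}_{\max}$ and the average extractable energy $S^{NP_1}_{av}$ obtained with type-1 NPOVMs do not depend on the noise: each of them takes the same value for all unitaries $U_{AE}$ on $\mathcal H_A\otimes\mathcal H_E$ (in particular the same value as for $U_{AE}=\mathbb I_{AE}$). (Type 2) For every initial state $\rho^0_S=\rho^0_{BAEX}$ that is not a product with respect to the bipartition $BAE:X$, the distillable energy $S^{NP_2}_D$, the maximum stochastically extractable energy $S^{NP_2}_{\max}$ and the average extractable energy $S^{NP_2}_{av}$ obtained with type-2 NPOVMs do not depend on the noise: each of them takes the same value for all unitaries $U_{AE}$ on $\mathcal H_A\otimes\mathcal H_E$ (in particular the same value as for $U_{AE}=\mathbb I_{AE}$).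
   Context: Starting from the initial density operator $\rho^0_S$ on $\mathcal H_B\otimes\mathcal H_A\otimes\mathcal H_E\otimes\mathcal H_X$, the state just before the measurement is $$\rho^2_S=(\mathbb I_B\otimes U_{AE}\otimes\mathbb I_X)(U_{BA}\otimes\mathbb I_E\otimes\mathbb I_X)\,\rho^0_S\,(U_{BA}^\dagger\otimes\mathbb I_E\otimes\mathbb I_X)(\mathbb I_B\otimes U_{AE}^\dagger\otimes\mathbb I_X).$$ In the type-1 case, $\rho^2_S=\rho^2_{BAE}\otimes\rho_X$ with $\rho^2_{BAE}=(\mathbb I_B\otimes U_{AE})(U_{BA}\otimes\mathbb I_E)\rho^0_{BAE}(U_{BA}^\dagger\otimes\mathbb I_E)(\mathbb I_B\otimes U_{AE}^\dagger)$. Let $\rho_B$ be the reduced state of $\rho^2_S$ on $\mathcal H_B$. Let $\mathcal K=\mathcal H_A\otimes\mathcal H_E$ and $\sigma=\rho^2_{BAE}$ for type-1 NPOVMs (projective measurement on $AE$), and $\mathcal K=\mathcal H_A\otimes\mathcal H_E\otimes\mathcal H_X$ and $\sigma=\rho^2_S$ for type-2 NPOVMs (projective measurement on $AEX$). A type-1 (resp. type-2) NPOVM (non-positive operator-valued measurement) on $A$ is implemented by a rank-one projective measurement given by an orthonormal basis $\Psi=\{|\Psi_i\rangle\}_i$ of $\mathcal K$. For outcome $i$, with unnormalized post-measurement state $\sigma_i=(\mathbb I_B\otimes|\Psi_i\rangle\langle\Psi_i|)\,\sigma\,(\mathbb I_B\otimes|\Psi_i\rangle\langle\Psi_i|)$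 and probability $p_i=\operatorname{tr}(\sigma_i)$, the probability-weighted extracted energy is $$s_i(\Psi)=p_i\operatorname{tr}[\rho_BH_B]-\operatorname{tr}\big[H_B\operatorname{tr}_{\mathcal K}(\sigma_i)\big].$$ The figures of merit are: distillable energy $S_D=\max_\Psi\sum_{i:\,s_i(\Psi)>0}s_i(\Psi)$ (empty sum $=0$); maximum stochastically extractable energy $S_{\max}=\max_\Psi\max_i s_i(\Psi)$; average extractable energy $S_{av}=\max_\Psi\sum_i s_i(\Psi)$; the maxima run over all orthonormal bases $\Psi$ of $\mathcal K$. They are denoted with superscript $NP_1$ for type 1 and $NP_2$ for type 2. *)

theory Defs
  imports "HOL-Analysis.Analysis"
begin

text \<open>
  A finite-dimensional Hilbert space is represented in an orthonormal basis as \<open>complex ^ 'n\<close> with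
  \<open>'n\<close> finite, and operators on it as square matrices.  The tensor product of the spaces with
  index types \<open>'m\<close> and \<open>'n\<close> has index type \<open>'m \<times> 'n\<close>.  Products of index types associate to the
  right, so that \<open>B \<otimes> K\<close> with \<open>K = A \<otimes> E\<close> or \<open>K = A \<otimes> E \<otimes> X\<close> needs no rebracketing.
\<close>

section \<open>Operators on finite-dimensional Hilbert spaces\<close>

text \<open>The inner product of HOL-Analysis on \<open>complex ^ 'n\<close> is the real part of the following one.\<close>

definition braket :: "complex ^ 'n \<Rightarrow> complex ^ 'n \<Rightarrow> complex" where
  "braket u v = (\<Sum>i\<in>UNIV. cnj (u $ i) * v $ i)"

definition ketbra :: "complex ^ 'n \<Rightarrow> complex ^ 'n \<Rightarrow> complex ^ 'n ^ 'n" where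
  "ketbra u v = (\<chi> i j. u $ i * cnj (v $ j))"

definition dagger :: "complex ^ 'n ^ 'n \<Rightarrow> complex ^ 'n ^ 'n" where
  "dagger A = (\<chi> i j. cnj (A $ j $ i))"

definition hermitian :: "complex ^ 'n ^ 'n \<Rightarrow> bool" where
  "hermitian A \<longleftrightarrow> dagger A = A"

definition unitary :: "complex ^ 'n ^ 'n \<Rightarrow> bool" where
  "unitary U \<longleftrightarrow> dagger U ** U = mat 1 \<and> U ** dagger U = mat 1"

definition positive_semidefinite :: "complex ^ 'n ^ 'n \<Rightarrow> bool" where
  "positive_semidefinite A \<longleftrightarrow> hermitian A \<and> (\<forall>v. 0 \<le> Re (braket v (A *v v)))"

definition density_operator :: "complex ^ 'n ^ 'n \<Rightarrow> bool" where
  "density_operator \<rho> \<longleftrightarrow> positive_semidefinite \<rho> \<and> trace \<rho> = 1"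

text \<open>A basis of the space is indexed by \<open>'n\<close> itself, which has as many elements as the dimension.\<close>

definition orthonormal_basis :: "('n \<Rightarrow> complex ^ 'n) \<Rightarrow> bool" where
  "orthonormal_basis \<Psi> \<longleftrightarrow>
     (\<forall>i j. braket (\<Psi> i) (\<Psi> j) = (if i = j then 1 else 0)) \<and> vec.span (range \<Psi>) = UNIV"

section \<open>Tensor products and partial trace\<close>

definition tensor_op ::
    "complex ^ 'm ^ 'm \<Rightarrow> complex ^ 'n ^ 'n \<Rightarrow> complex ^ ('m \<times> 'n) ^ ('m \<times> 'n)" (infixr \<open>\<otimes>\<^sub>o\<close> 75) where
  "A \<otimes>\<^sub>o B = (\<chi> p q. A $ fst p $ fst q * B $ snd p $ snd q)"

text \<open>Transport along a bijection of index types; only used to rebracket tensor products.\<close>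

definition rebracket :: "('p \<Rightarrow> 'q) \<Rightarrow> complex ^ 'q ^ 'q \<Rightarrow> complex ^ 'p ^ 'p" where
  "rebracket f A = (\<chi> p q. A $ f p $ f q)"

definition ptrace_snd :: "complex ^ ('m::finite \<times> 'n::finite) ^ ('m \<times> 'n) \<Rightarrow> complex ^ 'm ^ 'm" where
  "ptrace_snd A = (\<chi> i j. \<Sum>k\<in>UNIV. A $ (i, k) $ (j, k))"

section \<open>The state before the measurement\<close>

definition BA_on_BAE ::
    "complex ^ ('b::finite \<times> 'a::finite) ^ ('b \<times> 'a) \<Rightarrow> complex ^ ('b \<times> 'a \<times> 'e::finite) ^ ('b \<times> 'a \<times> 'e)" where
  "BA_on_BAE U = rebracket (\<lambda>(b, a, e). ((b, a), e)) (U \<otimes>\<^sub>o mat 1)"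

definition AE_on_BAE ::
    "complex ^ ('a::finite \<times> 'e::finite) ^ ('a \<times> 'e) \<Rightarrow> complex ^ ('b::finite \<times> 'a \<times> 'e) ^ ('b \<times> 'a \<times> 'e)" where
  "AE_on_BAE U = mat 1 \<otimes>\<^sub>o U"

definition BAE_tensor_X ::
    "complex ^ ('b::finite \<times> 'a::finite \<times> 'e::finite) ^ ('b \<times> 'a \<times> 'e) \<Rightarrow> complex ^ 'x ^ 'x \<Rightarrow>
     complex ^ ('b \<times> 'a \<times> 'e \<times> 'x) ^ ('b \<times> 'a \<times> 'e \<times> 'x)" where
  "BAE_tensor_X M N = rebracket (\<lambda>(b, a, e, x). ((b, a, e), x)) (M \<otimes>\<^sub>o N)"

definition rho2_BAE ::
    "complex ^ ('b::finite \<times> 'a::finite) ^ ('b \<times> 'a) \<Rightarrow> complex ^ ('a \<times> 'e::finite) ^ ('a \<times> 'e) \<Rightarrow>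
     complex ^ ('b \<times> 'a \<times> 'e) ^ ('b \<times> 'a \<times> 'e) \<Rightarrow>
     complex ^ ('b \<times> 'a \<times> 'e) ^ ('b \<times> 'a \<times> 'e)" where
  "rho2_BAE U_BA U_AE \<rho> =
     AE_on_BAE U_AE ** BA_on_BAE U_BA ** \<rho> **
     BA_on_BAE (dagger U_BA) ** AE_on_BAE (dagger U_AE)"

definition rho2_S ::
    "complex ^ ('b::finite \<times> 'a::finite) ^ ('b \<times> 'a) \<Rightarrow> complex ^ ('a \<times> 'e::finite) ^ ('a \<times> 'e) \<Rightarrow>
     complex ^ ('b \<times> 'a \<times> 'e \<times> 'x::finite) ^ ('b \<times> 'a \<times> 'e \<times> 'x) \<Rightarrow>
     complex ^ ('b \<times> 'a \<times> 'e \<times> 'x) ^ ('b \<times> 'a \<times> 'e \<times> 'x)" where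
  "rho2_S U_BA U_AE \<rho> =
     BAE_tensor_X (AE_on_BAE U_AE) (mat 1) ** BAE_tensor_X (BA_on_BAE U_BA) (mat 1) ** \<rho> **
     BAE_tensor_X (BA_on_BAE (dagger U_BA)) (mat 1) **
     BAE_tensor_X (AE_on_BAE (dagger U_AE)) (mat 1)"

definition product_BAE_X ::
    "complex ^ ('b::finite \<times> 'a::finite \<times> 'e::finite \<times> 'x::finite) ^ ('b \<times> 'a \<times> 'e \<times> 'x) \<Rightarrow> bool" where
  "product_BAE_X \<rho> \<longleftrightarrow>
     (\<exists>\<rho>\<^sub>1 \<rho>\<^sub>2. density_operator \<rho>\<^sub>1 \<and> density_operator \<rho>\<^sub>2 \<and> \<rho> = BAE_tensor_X \<rho>\<^sub>1 \<rho>\<^sub>2)"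

lemma BAE_tensor_X_mult:
  "BAE_tensor_X (M ** M') (N ** N') = BAE_tensor_X M N ** BAE_tensor_X M' N'"
proof -
  have bij: "bij (\<lambda>(b, a, e, x). ((b, a, e), x))"
    by (rule bij_betw_byWitness[where f' = "\<lambda>((b, a, e), x). (b, a, e, x)"]) auto
  have prod: "(\<Sum>r\<in>UNIV. M $ p $ r * M' $ r $ q) * (\<Sum>z\<in>UNIV. N $ x $ z * N' $ z $ y) =
        (\<Sum>(b, a, e, z)\<in>UNIV. M $ p $ (b, a, e) * M' $ (b, a, e) $ q * (N $ x $ z * N' $ z $ y))"
    for p q x y
    using sum.reindex_bij_betw[OF bij,
        of "\<lambda>(r, z). M $ p $ r * M' $ r $ q * (N $ x $ z * N' $ z $ y)"]
    unfolding sum_product sum.cartesian_product UNIV_Times_UNIV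
    by (simp only: case_prod_unfold fst_conv snd_conv prod.collapse)
  have "BAE_tensor_X (M ** M') (N ** N') $ (b, a, e, x) $ (b', a', e', x') =
        (BAE_tensor_X M N ** BAE_tensor_X M' N') $ (b, a, e, x) $ (b', a', e', x')"
    for b a e x b' a' e' x'
    unfolding BAE_tensor_X_def rebracket_def tensor_op_def matrix_matrix_mult_def
    by (simp only: vec_lambda_beta case_prod_unfold fst_conv snd_conv prod.collapse
        prod[unfolded case_prod_unfold prod.collapse]) (simp only: mult_ac)
  then show ?thesis
    by (simp add: vec_eq_iff)
qed

lemma rho2_S_product:
  "rho2_S U_BA U_AE (BAE_tensor_X \<rho>_BAE \<rho>_X) = BAE_tensor_X (rho2_BAE U_BA U_AE \<rho>_BAE) \<rho>_X"
  by (simp add: rho2_S_def rho2_BAE_def flip: BAE_tensor_X_mult)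

section \<open>Energy extraction by a rank-one projective measurement\<close>

definition post_state ::
    "complex ^ ('b::finite \<times> 'k::finite) ^ ('b \<times> 'k) \<Rightarrow> complex ^ 'k \<Rightarrow> complex ^ ('b \<times> 'k) ^ ('b \<times> 'k)" where
  "post_state \<sigma> \<psi> = (mat 1 \<otimes>\<^sub>o ketbra \<psi> \<psi>) ** \<sigma> ** (mat 1 \<otimes>\<^sub>o ketbra \<psi> \<psi>)"

text \<open>
  All traces below are real when \<open>H\<close>, \<open>\<rho>\<^sub>B\<close> and \<open>\<sigma>\<close> are Hermitian; taking \<open>Re\<close> only turns them
  into elements of \<open>real\<close>.
\<close>

definition extracted_energy ::
    "complex ^ 'b ^ 'b::finite \<Rightarrow> complex ^ 'b ^ 'b \<Rightarrow> complex ^ ('b \<times> 'k::finite) ^ ('b \<times> 'k) \<Rightarrow>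
     ('k \<Rightarrow> complex ^ 'k) \<Rightarrow> 'k \<Rightarrow> real" where
  "extracted_energy H \<rho>\<^sub>B \<sigma> \<Psi> i =
     Re (trace (post_state \<sigma> (\<Psi> i))) * Re (trace (\<rho>\<^sub>B ** H)) -
     Re (trace (H ** ptrace_snd (post_state \<sigma> (\<Psi> i))))"

definition max_over_bases :: "(('k \<Rightarrow> complex ^ 'k) \<Rightarrow> real) \<Rightarrow> real" where
  "max_over_bases f = (GREATEST v. \<exists>\<Psi>. orthonormal_basis \<Psi> \<and> v = f \<Psi>)"

definition distillable_energy ::
    "complex ^ 'b ^ 'b::finite \<Rightarrow> complex ^ 'b ^ 'b \<Rightarrow> complex ^ ('b \<times> 'k::finite) ^ ('b \<times> 'k) \<Rightarrow> real" where
  "distillable_energy H \<rho>\<^sub>B \<sigma> = max_over_bases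
     (\<lambda>\<Psi>. \<Sum>i | extracted_energy H \<rho>\<^sub>B \<sigma> \<Psi> i > 0. extracted_energy H \<rho>\<^sub>B \<sigma> \<Psi> i)"

definition max_stochastic_energy ::
    "complex ^ 'b ^ 'b::finite \<Rightarrow> complex ^ 'b ^ 'b \<Rightarrow> complex ^ ('b \<times> 'k::finite) ^ ('b \<times> 'k) \<Rightarrow> real" where
  "max_stochastic_energy H \<rho>\<^sub>B \<sigma> = max_over_bases
     (\<lambda>\<Psi>. Max (range (extracted_energy H \<rho>\<^sub>B \<sigma> \<Psi>)))"

definition average_energy ::
    "complex ^ 'b ^ 'b::finite \<Rightarrow> complex ^ 'b ^ 'b \<Rightarrow> complex ^ ('b \<times> 'k::finite) ^ ('b \<times> 'k) \<Rightarrow> real" where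
  "average_energy H \<rho>\<^sub>B \<sigma> = max_over_bases
     (\<lambda>\<Psi>. \<Sum>i\<in>UNIV. extracted_energy H \<rho>\<^sub>B \<sigma> \<Psi> i)"

section \<open>Figures of merit\<close>

text \<open>
  For type 1 the initial state is \<open>BAE_tensor_X \<rho>_BAE \<rho>_X\<close>; the reduced battery state is that of the
  full state, while the measurement acts on \<open>A \<otimes> E\<close> in the state \<open>rho2_BAE\<close>.
\<close>

definition S_D_NP1 where
  "S_D_NP1 H_B U_BA \<rho>_BAE \<rho>_X U_AE =
     distillable_energy H_B (ptrace_snd (rho2_S U_BA U_AE (BAE_tensor_X \<rho>_BAE \<rho>_X)))
       (rho2_BAE U_BA U_AE \<rho>_BAE)"

definition S_max_NP1 where
  "S_max_NP1 H_B U_BA \<rho>_BAE \<rho>_X U_AE =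
     max_stochastic_energy H_B (ptrace_snd (rho2_S U_BA U_AE (BAE_tensor_X \<rho>_BAE \<rho>_X)))
       (rho2_BAE U_BA U_AE \<rho>_BAE)"

definition S_av_NP1 where
  "S_av_NP1 H_B U_BA \<rho>_BAE \<rho>_X U_AE =
     average_energy H_B (ptrace_snd (rho2_S U_BA U_AE (BAE_tensor_X \<rho>_BAE \<rho>_X)))
       (rho2_BAE U_BA U_AE \<rho>_BAE)"

definition S_D_NP2 where
  "S_D_NP2 H_B U_BA \<rho>_S U_AE =
     distillable_energy H_B (ptrace_snd (rho2_S U_BA U_AE \<rho>_S)) (rho2_S U_BA U_AE \<rho>_S)"

definition S_max_NP2 where
  "S_max_NP2 H_B U_BA \<rho>_S U_AE =
     max_stochastic_energy H_B (ptrace_snd (rho2_S U_BA U_AE \<rho>_S)) (rho2_S U_BA U_AE \<rho>_S)"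

definition S_av_NP2 where
  "S_av_NP2 H_B U_BA \<rho>_S U_AE =
     average_energy H_B (ptrace_snd (rho2_S U_BA U_AE \<rho>_S)) (rho2_S U_BA U_AE \<rho>_S)"

section \<open>The maxima are attained\<close>

text \<open>Hence \<open>GREATEST\<close> in \<open>max_over_bases\<close> never denotes an unspecified value.\<close>

lemma orthonormal_family_spans:
  fixes \<Psi> :: "'n::finite \<Rightarrow> complex ^ 'n"
  assumes on: "\<And>i j. braket (\<Psi> i) (\<Psi> j) = (if i = j then 1 else 0)"
  shows "vec.span (range \<Psi>) = UNIV"
proof -
  have lin: "braket w (\<Sum>i\<in>UNIV. u i *s \<Psi> i) = (\<Sum>i\<in>UNIV. u i * braket w (\<Psi> i))" for u w
  proof -
    have "braket w (\<Sum>i\<in>UNIV. u i *s \<Psi> i) = (\<Sum>k\<in>UNIV. \<Sum>i\<in>UNIV. u i * (cnj (w $ k) * \<Psi> i $ k))"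
      by (simp add: braket_def sum_distrib_left algebra_simps)
    also have "\<dots> = (\<Sum>i\<in>UNIV. \<Sum>k\<in>UNIV. u i * (cnj (w $ k) * \<Psi> i $ k))"
      by (rule sum.swap)
    finally show ?thesis by (simp add: braket_def sum_distrib_left)
  qed
  have inj: "inj \<Psi>"
    by (rule injI) (metis on zero_neq_one)
  have "vec.independent (range \<Psi>)"
  proof (rule vec.independent_if_scalars_zero)
    fix f x
    assume z: "(\<Sum>x\<in>range \<Psi>. f x *s x) = 0" and "x \<in> range \<Psi>"
    then obtain j where j: "x = \<Psi> j" by blast
    have "(\<Sum>i\<in>UNIV. f (\<Psi> i) *s \<Psi> i) = 0"
      using z by (simp add: sum.reindex[OF inj])
    then have "(\<Sum>i\<in>UNIV. f (\<Psi> i) * braket (\<Psi> j) (\<Psi> i)) = 0"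
      using lin[of "\<Psi> j" "\<lambda>i. f (\<Psi> i)"] by (simp add: braket_def)
    then show "f x = 0" by (simp add: on j if_distrib cong: if_cong)
  qed simp
  then have "UNIV \<subseteq> vec.span (range \<Psi>)"
    by (intro vec.card_ge_dim_independent) (auto simp: card_image[OF inj] vec_dim_card simp del: vec.dim_UNIV)
  then show ?thesis by blast
qed

lemma compact_bases: "compact {M :: complex ^ 'n ^ 'n::finite. orthonormal_basis (($) M)}"
proof -
  let ?C = "{M :: complex ^ 'n ^ 'n. orthonormal_basis (($) M)}"
  have eq: "?C = (\<Inter>i. \<Inter>j. {M. braket (M $ i) (M $ j) = (if i = j then 1 else 0)})"
    using orthonormal_family_spans[of "($) M" for M] by (auto simp: orthonormal_basis_def)
  have "closed ?C"
    unfolding eq braket_def by (intro closed_INT ballI closed_Collect_eq continuous_intros)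
  moreover have "bounded ?C"
    unfolding bounded_iff
  proof (intro exI ballI)
    fix M assume "M \<in> ?C"
    then have on: "braket (M $ i) (M $ i) = 1" for i
      by (simp add: orthonormal_basis_def)
    have "norm (M $ i) = 1" for i
    proof -
      have "(norm (M $ i))\<^sup>2 = (\<Sum>k\<in>UNIV. (norm (M $ i $ k))\<^sup>2)"
        by (simp add: norm_vec_def L2_set_def sum_nonneg)
      then have "complex_of_real ((norm (M $ i))\<^sup>2) = (\<Sum>k\<in>UNIV. of_real ((norm (M $ i $ k))\<^sup>2))"
        by (simp only: of_real_sum)
      also have "\<dots> = braket (M $ i) (M $ i)"
        unfolding braket_def by (intro sum.cong refl) (simp only: complex_norm_square mult.commute)
      finally have "(norm (M $ i))\<^sup>2 = 1"
        by (simp only: on of_real_eq_1_iff)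
      then show ?thesis
        by (smt (verit) norm_ge_zero power2_eq_1_iff)
    qed
    then show "norm M \<le> sqrt (real CARD('n))"
      by (simp add: norm_vec_def[of M] L2_set_def)
  qed
  ultimately show ?thesis by (simp add: compact_eq_bounded_closed)
qed

lemma max_over_bases_attained:
  fixes f :: "('k::finite \<Rightarrow> complex ^ 'k) \<Rightarrow> real"
  assumes "continuous_on UNIV (\<lambda>M :: complex ^ 'k ^ 'k. f (($) M))"
  shows "\<exists>\<Psi>. orthonormal_basis \<Psi> \<and> max_over_bases f = f \<Psi> \<and>
           (\<forall>\<Phi>. orthonormal_basis \<Phi> \<longrightarrow> f \<Phi> \<le> f \<Psi>)"
proof -
  let ?C = "{M :: complex ^ 'k ^ 'k. orthonormal_basis (($) M)}"
  have on: "braket (axis i 1) (axis j 1) = (if i = j then 1 else 0)" for i j :: 'k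
  proof -
    have "braket (axis i 1) (axis j 1) =
          (\<Sum>k\<in>UNIV. if k = j then (if i = j then 1 else 0) else (0 :: complex))"
      unfolding braket_def axis_def by (intro sum.cong) auto
    then show ?thesis by simp
  qed
  have "($) (mat 1) = (\<lambda>i::'k. axis i (1 :: complex))"
    by (auto simp: fun_eq_iff vec_eq_iff mat_def axis_def)
  then have "mat 1 \<in> ?C"
    using on orthonormal_family_spans[OF on] by (simp add: orthonormal_basis_def)
  then obtain M where M: "M \<in> ?C" "\<And>N. N \<in> ?C \<Longrightarrow> f (($) N) \<le> f (($) M)"
    using continuous_attains_sup[OF compact_bases, of "\<lambda>M. f (($) M)"]
      continuous_on_subset[OF assms] by blast
  have le: "f \<Phi> \<le> f (($) M)" if "orthonormal_basis \<Phi>" for \<Phi>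
  proof -
    have "\<Phi> = ($) (\<chi> i. \<Phi> i)" by (simp add: fun_eq_iff)
    then show ?thesis using M(2)[of "\<chi> i. \<Phi> i"] that by simp
  qed
  then have "max_over_bases f = f (($) M)"
    unfolding max_over_bases_def using M(1) by (intro Greatest_equality) auto
  then show ?thesis using M(1) le by blast
qed

lemma continuous_extracted_energy:
  "continuous_on UNIV (\<lambda>M :: complex ^ 'k ^ 'k::finite. extracted_energy H \<rho>\<^sub>B \<sigma> (($) M) i)"
  unfolding extracted_energy_def post_state_def tensor_op_def ketbra_def ptrace_snd_def trace_def
    matrix_matrix_mult_def
  by (simp, intro continuous_intros)

lemma continuous_Max:
  fixes s :: "'k::finite \<Rightarrow> 'm::topological_space \<Rightarrow> real"
  assumes "\<And>i. continuous_on UNIV (s i)"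
  shows "continuous_on UNIV (\<lambda>M. Max (range (\<lambda>i. s i M)))"
proof -
  have "continuous_on UNIV (\<lambda>M. Max ((\<lambda>i. s i M) ` I))" if "finite I" "I \<noteq> {}" for I
    using that
  proof (induction I rule: finite_ne_induct)
    case (insert i I)
    then show ?case using assms[of i] by (simp add: continuous_on_max)
  qed (simp add: assms)
  then show ?thesis by simp
qed

lemma figures_of_merit_attained:
  fixes H \<rho>\<^sub>B :: "complex ^ 'b ^ 'b::finite" and \<sigma> :: "complex ^ ('b \<times> 'k) ^ ('b \<times> 'k::finite)"
  defines "s \<equiv> extracted_energy H \<rho>\<^sub>B \<sigma>"
  shows "\<exists>\<Psi>. orthonormal_basis \<Psi> \<and> distillable_energy H \<rho>\<^sub>B \<sigma> = (\<Sum>i | s \<Psi> i > 0. s \<Psi> i) \<and>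
           (\<forall>\<Phi>. orthonormal_basis \<Phi> \<longrightarrow> (\<Sum>i | s \<Phi> i > 0. s \<Phi> i) \<le> (\<Sum>i | s \<Psi> i > 0. s \<Psi> i))"
    and "\<exists>\<Psi>. orthonormal_basis \<Psi> \<and> max_stochastic_energy H \<rho>\<^sub>B \<sigma> = Max (range (s \<Psi>)) \<and>
           (\<forall>\<Phi>. orthonormal_basis \<Phi> \<longrightarrow> Max (range (s \<Phi>)) \<le> Max (range (s \<Psi>)))"
    and "\<exists>\<Psi>. orthonormal_basis \<Psi> \<and> average_energy H \<rho>\<^sub>B \<sigma> = (\<Sum>i\<in>UNIV. s \<Psi> i) \<and>
           (\<forall>\<Phi>. orthonormal_basis \<Phi> \<longrightarrow> (\<Sum>i\<in>UNIV. s \<Phi> i) \<le> (\<Sum>i\<in>UNIV. s \<Psi> i))"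
proof -
  have cont: "continuous_on UNIV (\<lambda>M :: complex ^ 'k ^ 'k. s (($) M) i)" for i
    unfolding s_def by (rule continuous_extracted_energy)
  have pos: "(\<Sum>i | g i > 0. g i) = (\<Sum>i\<in>UNIV. max 0 (g i))" for g :: "'k \<Rightarrow> real"
    by (rule sum.mono_neutral_cong_left) (auto simp: max_def)
  show "\<exists>\<Psi>. orthonormal_basis \<Psi> \<and> distillable_energy H \<rho>\<^sub>B \<sigma> = (\<Sum>i | s \<Psi> i > 0. s \<Psi> i) \<and>
           (\<forall>\<Phi>. orthonormal_basis \<Phi> \<longrightarrow> (\<Sum>i | s \<Phi> i > 0. s \<Phi> i) \<le> (\<Sum>i | s \<Psi> i > 0. s \<Psi> i))"
    unfolding distillable_energy_def s_def[symmetric]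
    by (rule max_over_bases_attained) (unfold pos, intro continuous_intros cont)
  show "\<exists>\<Psi>. orthonormal_basis \<Psi> \<and> max_stochastic_energy H \<rho>\<^sub>B \<sigma> = Max (range (s \<Psi>)) \<and>
           (\<forall>\<Phi>. orthonormal_basis \<Phi> \<longrightarrow> Max (range (s \<Phi>)) \<le> Max (range (s \<Psi>)))"
    unfolding max_stochastic_energy_def s_def[symmetric]
    by (rule max_over_bases_attained)
      (use continuous_Max[of "\<lambda>i M. s (($) M) i", OF cont] in simp)
  show "\<exists>\<Psi>. orthonormal_basis \<Psi> \<and> average_energy H \<rho>\<^sub>B \<sigma> = (\<Sum>i\<in>UNIV. s \<Psi> i) \<and>
           (\<forall>\<Phi>. orthonormal_basis \<Phi> \<longrightarrow> (\<Sum>i\<in>UNIV. s \<Phi> i) \<le> (\<Sum>i\<in>UNIV. s \<Psi> i))"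
    unfolding average_energy_def s_def[symmetric]
    by (rule max_over_bases_attained) (intro continuous_intros cont)
qed

end

theory Submission
  imports Defs
begin

text \<open>
  The noise conjugates the state by \<open>1 \<otimes> W\<close> with \<open>W\<close> a unitary on the measured space \<open>K\<close>.
  Replacing each basis vector \<open>\<psi>\<close> by \<open>W \<psi>\<close> conjugates the post-measurement states by the same
  \<open>1 \<otimes> W\<close>, which the partial trace over \<open>K\<close> does not see.  As \<open>\<Psi> \<mapsto> W \<Psi>\<close> permutes the
  orthonormal bases of \<open>K\<close>, the maxima coincide.
\<close>

text \<open>Common form of both cases: type 1 takes \<open>W = U_AE\<close> on A, E and type 2 takes
  \<open>U_AE\<close> tensored with the identity on X, so every invariance is proved once for an
  arbitrary measured space.\<close>

definition local_conj ::
    "complex ^ 'k ^ 'k \<Rightarrow> complex ^ ('b::finite \<times> 'k::finite) ^ ('b \<times> 'k) \<Rightarrow>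
     complex ^ ('b \<times> 'k) ^ ('b \<times> 'k)" where
  "local_conj W \<sigma> = (mat 1 \<otimes>\<^sub>o W) ** \<sigma> ** (mat 1 \<otimes>\<^sub>o dagger W)"

lemma tensor_op_mult:
  fixes A C :: "complex ^ 'm ^ 'm::finite" and B D :: "complex ^ 'n ^ 'n::finite"
  shows "(A \<otimes>\<^sub>o B) ** (C \<otimes>\<^sub>o D) = (A ** C) \<otimes>\<^sub>o (B ** D)"
  by (simp add: vec_eq_iff tensor_op_def matrix_matrix_mult_def sum_product sum.cartesian_product
      case_prod_unfold mult_ac)

lemma tensor_op_mat_1: "mat 1 \<otimes>\<^sub>o mat 1 = mat 1"
  by (auto simp: vec_eq_iff tensor_op_def mat_def)

lemma dagger_dagger [simp]: "dagger (dagger A) = A"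
  by (simp add: dagger_def vec_eq_iff)

lemma dagger_mat_1 [simp]: "dagger (mat 1) = mat 1"
  by (auto simp: dagger_def mat_def vec_eq_iff)

lemma dagger_tensor_op: "dagger (A \<otimes>\<^sub>o B) = dagger A \<otimes>\<^sub>o dagger B"
  by (simp add: dagger_def tensor_op_def vec_eq_iff)

lemma unitary_dagger: "unitary U \<Longrightarrow> unitary (dagger U)"
  by (simp add: unitary_def)

lemma unitary_tensor_op:
  fixes U :: "complex ^ 'm ^ 'm::finite" and V :: "complex ^ 'n ^ 'n::finite"
  assumes "unitary U" "unitary V"
  shows "unitary (U \<otimes>\<^sub>o V)"
  using assms by (simp add: unitary_def dagger_tensor_op tensor_op_mult tensor_op_mat_1)

lemma braket_mult_right:
  fixes A :: "complex ^ 'n ^ 'n::finite"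
  shows "braket u (A *v v) = braket (dagger A *v u) v"
proof -
  have "braket u (A *v v) = (\<Sum>i\<in>UNIV. \<Sum>j\<in>UNIV. cnj (u $ i) * A $ i $ j * v $ j)"
    by (simp add: braket_def matrix_vector_mult_def sum_distrib_left mult_ac)
  also have "\<dots> = (\<Sum>j\<in>UNIV. \<Sum>i\<in>UNIV. cnj (u $ i) * A $ i $ j * v $ j)"
    by (rule sum.swap)
  also have "\<dots> = braket (dagger A *v u) v"
    by (simp add: braket_def matrix_vector_mult_def dagger_def sum_distrib_left sum_distrib_right mult_ac)
  finally show ?thesis .
qed

lemma braket_unitary:
  fixes W :: "complex ^ 'n ^ 'n::finite"
  assumes "unitary W"
  shows "braket (W *v u) (W *v v) = braket u v"
  using assms by (simp add: braket_mult_right matrix_vector_mul_assoc unitary_def)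

text \<open>Unitaries preserve \<open>braket\<close>, hence orthonormality; spanning then follows by
  counting dimensions (\<open>orthonormal_family_spans\<close>).\<close>

lemma orthonormal_basis_unitary:
  fixes W :: "complex ^ 'n ^ 'n::finite"
  assumes "unitary W" "orthonormal_basis \<Psi>"
  shows "orthonormal_basis (\<lambda>i. W *v \<Psi> i)"
proof -
  have "braket (W *v \<Psi> i) (W *v \<Psi> j) = (if i = j then 1 else 0)" for i j
    using assms by (simp add: braket_unitary orthonormal_basis_def)
  then show ?thesis
    using orthonormal_family_spans[of "\<lambda>i. W *v \<Psi> i"] by (simp add: orthonormal_basis_def)
qed

text \<open>\<open>max_over_bases\<close> depends only on the set of values taken on orthonormal
  bases, and \<open>f\<close> and \<open>g\<close> take the same values because \<open>W\<close>
  permutes these bases.\<close>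

lemma max_over_bases_unitary:
  fixes W :: "complex ^ 'k ^ 'k::finite"
  assumes W: "unitary W" and fg: "\<And>\<Psi>. f (\<lambda>i. W *v \<Psi> i) = g \<Psi>"
  shows "max_over_bases f = max_over_bases g"
proof -
  have "(\<exists>\<Psi>. orthonormal_basis \<Psi> \<and> v = f \<Psi>) \<longleftrightarrow> (\<exists>\<Psi>. orthonormal_basis \<Psi> \<and> v = g \<Psi>)" for v
  proof
    assume "\<exists>\<Psi>. orthonormal_basis \<Psi> \<and> v = f \<Psi>"
    then obtain \<Psi> where \<Psi>: "orthonormal_basis \<Psi>" "v = f \<Psi>" by blast
    \<comment> \<open>This is \<open>fg\<close> at the basis rotated back by
      \<open>dagger W\<close>, where \<open>W ** dagger W\<close> cancels.\<close>
    have "f \<Psi> = g (\<lambda>i. dagger W *v \<Psi> i)"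
      using W by (simp add: matrix_vector_mul_assoc unitary_def flip: fg)
    then show "\<exists>\<Psi>. orthonormal_basis \<Psi> \<and> v = g \<Psi>"
      using \<Psi> orthonormal_basis_unitary[OF unitary_dagger[OF W]] by blast
  next
    assume "\<exists>\<Psi>. orthonormal_basis \<Psi> \<and> v = g \<Psi>"
    then show "\<exists>\<Psi>. orthonormal_basis \<Psi> \<and> v = f \<Psi>"
      using orthonormal_basis_unitary[OF W] fg by metis
  qed
  then show ?thesis by (simp add: max_over_bases_def)
qed

lemma ketbra_mult:
  fixes A :: "complex ^ 'n ^ 'n::finite"
  shows "ketbra (A *v u) (A *v v) = A ** ketbra u v ** dagger A"
proof -
  have "ketbra (A *v u) (A *v v) $ i $ j = (A ** ketbra u v ** dagger A) $ i $ j" for i j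
  proof -
    have "ketbra (A *v u) (A *v v) $ i $ j =
          (\<Sum>k\<in>UNIV. \<Sum>l\<in>UNIV. A $ i $ k * u $ k * cnj (A $ j $ l * v $ l))"
      by (simp add: ketbra_def matrix_vector_mult_def sum_product)
    also have "\<dots> = (\<Sum>l\<in>UNIV. \<Sum>k\<in>UNIV. A $ i $ k * u $ k * cnj (A $ j $ l * v $ l))"
      by (rule sum.swap)
    also have "\<dots> = (A ** ketbra u v ** dagger A) $ i $ j"
      by (simp add: ketbra_def dagger_def matrix_matrix_mult_def sum_distrib_left
          sum_distrib_right mult_ac)
    finally show ?thesis .
  qed
  then show ?thesis by (simp add: vec_eq_iff)
qed

text \<open>The Kronecker delta is the battery factor of an entry of
  \<open>mat 1 \<otimes>\<^sub>o W\<close>; it collapses the sum in a matrix product to the index of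
  the measured space.\<close>

lemma sum_prod_delta:
  fixes f :: "'b::finite \<times> 'k::finite \<Rightarrow> complex"
  shows "(\<Sum>r\<in>UNIV. (if i = fst r then 1 else 0) * f r) = (\<Sum>l\<in>UNIV. f (i, l))"
proof -
  have "(\<Sum>r\<in>UNIV. (if i = fst r then 1 else 0) * f r) =
        (\<Sum>b\<in>UNIV. \<Sum>l\<in>UNIV. (if i = b then 1 else 0) * f (b, l))"
    by (simp add: sum.cartesian_product case_prod_unfold)
  also have "\<dots> = (\<Sum>b\<in>UNIV. if i = b then \<Sum>l\<in>UNIV. f (b, l) else 0)"
    by (intro sum.cong) auto
  finally show ?thesis by simp
qed

text \<open>Cyclicity of the trace at fixed battery indices: since \<open>W\<close> acts on the
  traced factor alone, both sides have as entry the same double sum of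
  \<open>W $ k $ l * M $ (i, l) $ (j, k)\<close>, summed in different orders.\<close>

lemma ptrace_snd_cyclic:
  fixes M :: "complex ^ ('b::finite \<times> 'k::finite) ^ ('b \<times> 'k)"
  shows "ptrace_snd ((mat 1 \<otimes>\<^sub>o W) ** M) = ptrace_snd (M ** (mat 1 \<otimes>\<^sub>o W))"
proof -
  have "ptrace_snd ((mat 1 \<otimes>\<^sub>o W) ** M) $ i $ j = ptrace_snd (M ** (mat 1 \<otimes>\<^sub>o W)) $ i $ j" for i j
  proof -
    have "ptrace_snd ((mat 1 \<otimes>\<^sub>o W) ** M) $ i $ j =
          (\<Sum>k\<in>UNIV. \<Sum>l\<in>UNIV. W $ k $ l * M $ (i, l) $ (j, k))"
      using sum_prod_delta[of i "\<lambda>r. W $ k $ snd r * M $ r $ (j, k)" for k]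
      by (simp add: ptrace_snd_def matrix_matrix_mult_def tensor_op_def mat_def mult.assoc)
    also have "\<dots> = (\<Sum>l\<in>UNIV. \<Sum>k\<in>UNIV. W $ k $ l * M $ (i, l) $ (j, k))"
      by (rule sum.swap)
    also have "\<dots> = ptrace_snd (M ** (mat 1 \<otimes>\<^sub>o W)) $ i $ j"
      using sum_prod_delta[of j "\<lambda>r. W $ snd r $ l * M $ (i, l) $ r" for l]
      by (simp add: ptrace_snd_def matrix_matrix_mult_def tensor_op_def mat_def mult_ac eq_commute)
    finally show ?thesis .
  qed
  then show ?thesis by (simp add: vec_eq_iff)
qed

text \<open>Lets the outcome probability, a full trace, inherit the invariance of the partial
  trace.\<close>

lemma trace_ptrace_snd: "trace (ptrace_snd M) = trace M"
  by (simp add: trace_def ptrace_snd_def sum.cartesian_product case_prod_unfold)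

text \<open>Cyclicity brings \<open>dagger W\<close> next to \<open>W\<close>. This serves both the
  post-measurement states and the reduced battery state \<open>\<rho>\<^sub>B\<close>.\<close>

lemma ptrace_snd_local_conj:
  assumes "unitary W"
  shows "ptrace_snd (local_conj W \<sigma>) = ptrace_snd \<sigma>"
proof -
  have "ptrace_snd (local_conj W \<sigma>) = ptrace_snd (\<sigma> ** ((mat 1 \<otimes>\<^sub>o dagger W) ** (mat 1 \<otimes>\<^sub>o W)))"
    by (simp add: local_conj_def ptrace_snd_cyclic flip: matrix_mul_assoc)
  then show ?thesis
    using assms by (simp add: tensor_op_mult tensor_op_mat_1 unitary_def)
qed

lemma post_state_local_conj:
  fixes W :: "complex ^ 'k ^ 'k::finite" and \<sigma> :: "complex ^ ('b::finite \<times> 'k) ^ ('b \<times> 'k)"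
  assumes "unitary W"
  shows "post_state (local_conj W \<sigma>) (W *v \<psi>) = local_conj W (post_state \<sigma> \<psi>)"
proof -
  let ?T = "\<lambda>A. (mat 1 :: complex ^ 'b ^ 'b) \<otimes>\<^sub>o A"
    and ?P = "ketbra \<psi> \<psi>" and ?Q = "ketbra (W *v \<psi>) (W *v \<psi>)"
  \<comment> \<open>The rotated projector is \<open>W ** ?P ** dagger W\<close>. Once
    \<open>dagger W ** W\<close> cancels, these identities carry \<open>W\<close> outward past the
    measurement on either side.\<close>
  have "?Q ** W = W ** ?P ** (dagger W ** W)" "dagger W ** ?Q = (dagger W ** W) ** ?P ** dagger W"
    by (simp_all only: ketbra_mult matrix_mul_assoc)
  then have "?T ?Q ** ?T W = ?T W ** ?T ?P" "?T (dagger W) ** ?T ?Q = ?T ?P ** ?T (dagger W)"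
    using assms by (simp_all add: tensor_op_mult unitary_def)
  moreover have "post_state (local_conj W \<sigma>) (W *v \<psi>) =
      (?T ?Q ** ?T W) ** \<sigma> ** (?T (dagger W) ** ?T ?Q)"
    by (simp add: post_state_def local_conj_def matrix_mul_assoc)
  ultimately show ?thesis
    by (simp add: post_state_def local_conj_def matrix_mul_assoc)
qed

lemma extracted_energy_local_conj:
  assumes "unitary W"
  shows "extracted_energy H \<rho>\<^sub>B (local_conj W \<sigma>) (\<lambda>i. W *v \<Psi> i) = extracted_energy H \<rho>\<^sub>B \<sigma> \<Psi>"
  using assms
  by (simp add: fun_eq_iff extracted_energy_def post_state_local_conj ptrace_snd_local_conj
      flip: trace_ptrace_snd)

text \<open>Each figure of merit sees the basis and the measured state only through the outcome
  energies, which are unchanged when both are rotated by \<open>W\<close>. Here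
  \<open>\<rho>\<^sub>B\<close> is held fixed.\<close>

lemma figures_of_merit_local_conj:
  assumes "unitary W"
  shows "distillable_energy H \<rho>\<^sub>B (local_conj W \<sigma>) = distillable_energy H \<rho>\<^sub>B \<sigma>"
    and "max_stochastic_energy H \<rho>\<^sub>B (local_conj W \<sigma>) = max_stochastic_energy H \<rho>\<^sub>B \<sigma>"
    and "average_energy H \<rho>\<^sub>B (local_conj W \<sigma>) = average_energy H \<rho>\<^sub>B \<sigma>"
  unfolding distillable_energy_def max_stochastic_energy_def average_energy_def
  by (intro max_over_bases_unitary[OF assms]; simp only: extracted_energy_local_conj[OF assms])+

lemma rho2_BAE_local_conj:
  "rho2_BAE U_BA U_AE \<rho> = local_conj U_AE (BA_on_BAE U_BA ** \<rho> ** BA_on_BAE (dagger U_BA))"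
  by (simp add: rho2_BAE_def local_conj_def AE_on_BAE_def matrix_mul_assoc)

text \<open>Associativity of the tensor product: the noise is regrouped from BAE : X to B : AEX, so
  that it acts on the measured factor.\<close>

lemma AE_on_BAE_tensor_X: "BAE_tensor_X (AE_on_BAE U) (mat 1) =
    mat 1 \<otimes>\<^sub>o rebracket (\<lambda>(a, e, x). ((a, e), x)) (U \<otimes>\<^sub>o mat 1)"
  by (simp add: vec_eq_iff BAE_tensor_X_def AE_on_BAE_def rebracket_def tensor_op_def mult.assoc)

text \<open>Gives the measured state of type 2, and the reduced battery state in both types. The
  conjugated state does not contain \<open>U_AE\<close>.\<close>

lemma rho2_S_local_conj:
  fixes \<rho> :: "complex ^ ('b::finite \<times> 'a::finite \<times> 'e::finite \<times> 'x::finite) ^ ('b \<times> 'a \<times> 'e \<times> 'x)"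
  shows "rho2_S U_BA U_AE \<rho> = local_conj (rebracket (\<lambda>(a, e, x). ((a, e), x)) (U_AE \<otimes>\<^sub>o mat 1))
     (BAE_tensor_X (BA_on_BAE U_BA) (mat 1) ** \<rho> ** BAE_tensor_X (BA_on_BAE (dagger U_BA)) (mat 1))"
proof -
  have "dagger (rebracket (\<lambda>(a, e, x). ((a, e), x)) (U_AE \<otimes>\<^sub>o (mat 1 :: complex ^ 'x ^ 'x))) =
        rebracket (\<lambda>(a, e, x). ((a, e), x)) (dagger U_AE \<otimes>\<^sub>o mat 1)"
    by (auto simp: vec_eq_iff dagger_def rebracket_def tensor_op_def mat_def)
  then show ?thesis
    by (simp add: rho2_S_def local_conj_def AE_on_BAE_tensor_X matrix_mul_assoc)
qed

lemma rebracket_mult: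
  fixes A B :: "complex ^ 'q ^ 'q::finite" and f :: "'p::finite \<Rightarrow> 'q"
  assumes "bij f"
  shows "rebracket f (A ** B) = rebracket f A ** rebracket f B"
  using sum.reindex_bij_betw[OF assms, of "\<lambda>r. A $ f p $ r * B $ r $ f q" for p q]
  by (simp add: vec_eq_iff rebracket_def matrix_matrix_mult_def)

lemma unitary_rebracket:
  fixes U :: "complex ^ 'q ^ 'q::finite" and f :: "'p::finite \<Rightarrow> 'q"
  assumes "bij f" "unitary U"
  shows "unitary (rebracket f U)"
proof -
  have "dagger (rebracket f U) = rebracket f (dagger U)"
    by (simp add: vec_eq_iff dagger_def rebracket_def)
  moreover have "rebracket f (mat 1) = mat 1"
    using bij_is_inj[OF assms(1)] by (auto simp: vec_eq_iff rebracket_def mat_def inj_eq)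
  ultimately show ?thesis
    using assms by (simp add: unitary_def flip: rebracket_mult)
qed

lemma unitary_AE_tensor_X:
  fixes U :: "complex ^ ('a::finite \<times> 'e::finite) ^ ('a \<times> 'e)"
  assumes "unitary U"
  shows "unitary (rebracket (\<lambda>(a, e, x). ((a, e), x)) (U \<otimes>\<^sub>o (mat 1 :: complex ^ 'x ^ 'x::finite)))"
proof (rule unitary_rebracket)
  show "bij (\<lambda>(a, e, x). ((a, e), x))"
    by (rule bij_betw_byWitness[where f' = "\<lambda>((a, e), x). (a, e, x)"]) auto
  have "unitary (mat 1 :: complex ^ 'x ^ 'x)"
    by (simp add: unitary_def)
  then show "unitary (U \<otimes>\<^sub>o (mat 1 :: complex ^ 'x ^ 'x))"
    by (rule unitary_tensor_op[OF assms])
qed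

theorem theorem4:
  fixes H_B :: "complex ^ 'b ^ 'b::finite"
    and U_BA :: "complex ^ ('b \<times> 'a::finite) ^ ('b \<times> 'a)"
  assumes "hermitian H_B" and "unitary U_BA"
  shows
    "(\<forall>(\<rho>_BAE :: complex ^ ('b \<times> 'a \<times> 'e::finite) ^ ('b \<times> 'a \<times> 'e))
       (\<rho>_X :: complex ^ 'x ^ 'x::finite).
       density_operator \<rho>_BAE \<and> density_operator \<rho>_X \<longrightarrow>
       (\<forall>U_AE U_AE'. unitary U_AE \<and> unitary U_AE' \<longrightarrow>
          S_D_NP1 H_B U_BA \<rho>_BAE \<rho>_X U_AE = S_D_NP1 H_B U_BA \<rho>_BAE \<rho>_X U_AE' \<and>
          S_max_NP1 H_B U_BA \<rho>_BAE \<rho>_X U_AE = S_max_NP1 H_B U_BA \<rho>_BAE \<rho>_X U_AE' \<and>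
          S_av_NP1 H_B U_BA \<rho>_BAE \<rho>_X U_AE = S_av_NP1 H_B U_BA \<rho>_BAE \<rho>_X U_AE'))
     \<and>
     (\<forall>\<rho>_S :: complex ^ ('b \<times> 'a \<times> 'e \<times> 'x) ^ ('b \<times> 'a \<times> 'e \<times> 'x).
       density_operator \<rho>_S \<and> \<not> product_BAE_X \<rho>_S \<longrightarrow>
       (\<forall>U_AE U_AE'. unitary U_AE \<and> unitary U_AE' \<longrightarrow>
          S_D_NP2 H_B U_BA \<rho>_S U_AE = S_D_NP2 H_B U_BA \<rho>_S U_AE' \<and>
          S_max_NP2 H_B U_BA \<rho>_S U_AE = S_max_NP2 H_B U_BA \<rho>_S U_AE' \<and>
          S_av_NP2 H_B U_BA \<rho>_S U_AE = S_av_NP2 H_B U_BA \<rho>_S U_AE'))"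
  \<comment> \<open>The noise leaves \<open>\<rho>\<^sub>B\<close> through the partial trace and the
    measured state through the maximum over bases, so both sides reduce to one expression free of
    \<open>U_AE\<close> and \<open>U_AE'\<close>.\<close>
  by (simp add: S_D_NP1_def S_max_NP1_def S_av_NP1_def S_D_NP2_def S_max_NP2_def S_av_NP2_def
      rho2_BAE_local_conj rho2_S_local_conj figures_of_merit_local_conj ptrace_snd_local_conj
      unitary_AE_tensor_X)

end
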